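(* Let $\alpha\approx 1.46557123$ be the unique real root of $X^3-X^2-1$. Let $(a(j))_{j\ge1}$ be the increasing enumeration of the positive integers $k$ such that $(k)_N$ ends in a $1$ followed by exactly $3s$ or $3s+2$ zeros for some $s\ge0$, and let $(b(j))_{j\ge1}$ be the increasing enumeration of the positive integers $k$ such that $(k)_N$ ends in a $1$ followed by exactly $3s+1$ zeros for some $s\ge 0$. Then (i) $-1.2630921 < a(i)-\alpha i < 0.58304372$ for all $i\ge 1$; (ii) $-2.2480941 < b(i)-\alpha^3 i < 0.558039$ for all $i\ge1$.
   Context: The Narayana numbers $(N_i)_{i\in\mathbb Z}$ are defined by $N_0=1$, $N_1=2$, $N_2=3$ and $N_i=N_{i-1}+N_{i-3}$ for all integers $i$ (so $N_{-1}=N_{-2}=1$, $N_3=4$, $N_4=6$, $N_5=9,\dots$). Every nonnegative integer $m$ has a unique Narayana representation $(m)_N=e_1\cdots e_t\in\{0,1\}^*$ with $m=\sum_{i=1}^t e_iN_{t-i}$, $e_1=1$ when $t\ge1$, and containing no factor $11$ or $101$; $(0)_N$ is the empty word. *)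

theory Defs
  imports Complex_Main "HOL-Library.Infinite_Set" "HOL-Library.Sublist"
begin

text \<open>Only indices \<open>i \<ge> 0\<close> occur in Narayana representations, so the two-sided
  sequence is restricted to the natural numbers.\<close>

fun narayana :: "nat \<Rightarrow> nat" where
  "narayana 0 = 1"
| "narayana (Suc 0) = 2"
| "narayana (Suc (Suc 0)) = 3"
| "narayana (Suc (Suc (Suc i))) = narayana (Suc (Suc i)) + narayana i"

text \<open>Words are written most significant digit first; the digit \<open>e\<^sub>i\<close> of
  \<open>e\<^sub>1 \<dots> e\<^sub>t\<close> is \<open>w ! (i - 1)\<close>.\<close>

definition is_narayana_rep :: "nat list \<Rightarrow> nat \<Rightarrow> bool" where
  "is_narayana_rep w m \<longleftrightarrow>
     set w \<subseteq> {0, 1} \<and>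
     m = (\<Sum>i = 1..length w. w ! (i - 1) * narayana (length w - i)) \<and>
     (w \<noteq> [] \<longrightarrow> hd w = 1) \<and>
     \<not> sublist [1, 1] w \<and> \<not> sublist [1, 0, 1] w"

definition narayana_rep :: "nat \<Rightarrow> nat list" where
  "narayana_rep m = (THE w. is_narayana_rep w m)"

definition ends_one_zeros :: "nat list \<Rightarrow> nat \<Rightarrow> bool" where
  "ends_one_zeros w z \<longleftrightarrow> (\<exists>u. w = u @ [1] @ replicate z 0)"

definition setA :: "nat set" where
  "setA = {k. k > 0 \<and> (\<exists>s. ends_one_zeros (narayana_rep k) (3 * s) \<or>
                             ends_one_zeros (narayana_rep k) (3 * s + 2))}"

definition setB :: "nat set" where
  "setB = {k. k > 0 \<and> (\<exists>s. ends_one_zeros (narayana_rep k) (3 * s + 1))}"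

text \<open>The library enumeration of an infinite set of natural numbers starts at index \<open>0\<close>;
  the sequences here are indexed by \<open>j \<ge> 1\<close>.\<close>

definition seqA :: "nat \<Rightarrow> nat" where
  "seqA j = enumerate setA (j - 1)"

definition seqB :: "nat \<Rightarrow> nat" where
  "seqB j = enumerate setB (j - 1)"

definition alpha :: real where
  "alpha = (THE x::real. x ^ 3 - x ^ 2 - 1 = 0)"

end

theory Submission
  imports Defs
begin

text \<open>
  Let $r(k)$ count the elements of the first set up to $k$ and let $E(k) = k - \alpha r(k)$.
  Prepending a leading digit does not change how a representation ends, so $r$ and $E$ are additive
  over the digits: $E(k) = \sum_p d_p$ over the positions $p$ of the ones, where
  $d_p = E(N_p) = N_p - \alpha N_{p-1}$. The component of $d$ along $\alpha$ vanishes, so $d_p$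
  decays like $\alpha^{-p/2}$. As ones are at least three positions apart, the maximum $M_n$ of the
  sums over words of length $n$ satisfies $M_{n+1} = \max(M_n, M_{n-2} + d_n)$; twenty-five
  rational steps of this recursion and a geometric tail give $-1.2598 < E(k) < 1.0466$ for all $k$.
  For $k$ in the first set $E(k) = E(k-1) + 1 - \alpha$, and for $k$ in the second one
  $E(k) = E(k-1) + 1$, which improves one side of the bound in each case. Since the ranks in the two
  sets add up to $k$, the error in the second claim equals $-\alpha^2 E(k)$.
\<close>

section \<open>Narayana numbers and functions additive over their digits\<close>

text \<open>Truncated subtraction is harmless here and below because $N_{-2} = N_{-1} = N_0 = 1$.\<close>

lemma narayana_Suc: "narayana (Suc n) = narayana n + narayana (n - 2)"
  by (cases n rule: narayana.cases) auto

lemma narayana_add_3: "narayana (n + 3) = narayana (n + 2) + narayana n"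
  by (simp add: numeral_3_eq_3)

lemma narayana_pos [simp]: "0 < narayana n"
  by (induction n) (simp_all add: narayana_Suc)

lemma strict_mono_narayana: "strict_mono narayana"
  by (simp add: strict_mono_Suc_iff narayana_Suc)

lemma narayana_le_iff: "narayana m \<le> narayana n \<longleftrightarrow> m \<le> n"
  by (rule strict_mono_less_eq[OF strict_mono_narayana])

lemma less_narayana: "n < narayana n"
proof (induction n)
  case (Suc n)
  then show ?case using narayana_pos[of "n - 2"] unfolding narayana_Suc by linarith
qed simp

lemma less_narayana_Suc_cases:
  assumes "k < narayana (Suc n)"
  obtains (below) "k < narayana n" | (add) m where "k = narayana n + m" "m < narayana (n - 2)"
  using assms by (cases "k < narayana n") (auto simp: narayana_Suc not_less le_iff_add)

lemma narayana_add_induct [case_names 0 add]: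
  assumes "P 0"
    and "\<And>n m. m < narayana (n - 2) \<Longrightarrow> P m \<Longrightarrow> P (narayana n + m)"
  shows "P k"
proof -
  have "P k" if "k < narayana n" for n
    using that
  proof (induction n arbitrary: k)
    case (Suc n)
    from Suc.prems show ?case
    proof (cases rule: less_narayana_Suc_cases)
      case below
      then show ?thesis by (rule Suc.IH)
    next
      case (add m)
      moreover have "narayana (n - 2) \<le> narayana n" by (simp add: narayana_le_iff)
      ultimately show ?thesis using Suc.IH[of m] assms(2) by simp
    qed
  qed (use assms(1) in simp)
  then show ?thesis using less_narayana by blast
qed

definition narayana_additive :: "(nat \<Rightarrow> 'a::plus) \<Rightarrow> bool" where
  "narayana_additive G \<longleftrightarrow>
     (\<forall>n. \<forall>m < narayana (n - 2). G (narayana n + m) = G (narayana n) + G m)"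

lemma narayana_additiveD:
  "narayana_additive G \<Longrightarrow> m < narayana (n - 2) \<Longrightarrow> G (narayana n + m) = G (narayana n) + G m"
  by (simp add: narayana_additive_def)

lemma narayana_additive_0:
  fixes G :: "nat \<Rightarrow> 'a::cancel_comm_monoid_add"
  assumes "narayana_additive G"
  shows "G 0 = 0"
  using narayana_additiveD[OF assms, of 0 0] by simp

lemma narayana_additive_uminus:
  fixes G :: "nat \<Rightarrow> 'a::ab_group_add"
  shows "narayana_additive G \<Longrightarrow> narayana_additive (\<lambda>k. - G k)"
  by (simp add: narayana_additive_def)

fun max_digit_sum :: "(nat \<Rightarrow> 'a::linordered_ab_group_add) \<Rightarrow> nat \<Rightarrow> 'a" where
  "max_digit_sum v 0 = 0"
| "max_digit_sum v (Suc n) = max (max_digit_sum v n) (max_digit_sum v (n - 2) + v n)"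

lemma additive_le_max_digit_sum:
  fixes G :: "nat \<Rightarrow> 'a::linordered_ab_group_add"
  assumes "narayana_additive G"
    and "\<And>p. p < n \<Longrightarrow> G (narayana p) \<le> v p"
    and "k < narayana n"
  shows "G k \<le> max_digit_sum v n"
  using assms(2,3)
proof (induction v n arbitrary: k rule: max_digit_sum.induct)
  case (1 v)
  then show ?case by (simp add: narayana_additive_0[OF assms(1)])
next
  case (2 v n)
  from "2.prems"(2) show ?case
  proof (cases rule: less_narayana_Suc_cases)
    case below
    then have "G k \<le> max_digit_sum v n" using "2.IH"(1) "2.prems"(1) by simp
    then show ?thesis by (simp add: le_max_iff_disj)
  next
    case (add m)
    have "G k = G m + G (narayana n)"
      using narayana_additiveD[OF assms(1)] add by (simp add: add.commute)
    also have "\<dots> \<le> max_digit_sum v (n - 2) + v n"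
      using "2.IH"(2)[of m] "2.prems"(1) add by (intro add_mono) simp_all
    finally show ?thesis by (simp add: le_max_iff_disj)
  qed
qed

text \<open>Evaluating the defining equations of \<^const>\<open>max_digit_sum\<close> takes exponential time; this
  version carries the last three weights and maxima along.\<close>

fun max_digit_sum_iter ::
    "nat \<Rightarrow> 'a \<Rightarrow> 'a \<Rightarrow> 'a \<Rightarrow> 'a \<Rightarrow> 'a \<Rightarrow> 'a \<Rightarrow> 'a::linordered_ab_group_add" where
  "max_digit_sum_iter 0 x y z p q r = p"
| "max_digit_sum_iter (Suc k) x y z p q r = max_digit_sum_iter k y z (z + x) q r (max r (p + z))"

lemma max_digit_sum_eq_iter:
  assumes "\<And>n. v (n + 3) = v (n + 2) + v n"
  shows "max_digit_sum v (n + k) = max_digit_sum_iter k (v n) (v (n + 1)) (v (n + 2))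
    (max_digit_sum v n) (max_digit_sum v (n + 1)) (max_digit_sum v (n + 2))"
proof (induction k arbitrary: n)
  case (Suc k)
  then show ?case using Suc[of "Suc n"] assms[of n] by (simp add: numeral_3_eq_3)
qed simp

lemma max_digit_sum_eq_iter_0:
  assumes "\<And>n. v (n + 3) = v (n + 2) + v n"
  shows "max_digit_sum v k =
    max_digit_sum_iter k (v 0) (v 1) (v 2) 0 (max 0 (v 0)) (max (max 0 (v 0)) (v 1))"
  using max_digit_sum_eq_iter[OF assms, of 0 k] by (simp add: numeral_2_eq_2)

lemma additive_le_partial_geometric_tail:
  fixes G :: "nat \<Rightarrow> 'a::linordered_idom"
  assumes additive: "narayana_additive G"
    and prefix: "\<And>k. k < narayana L \<Longrightarrow> G k \<le> B"
    and tail: "\<And>i. G (narayana (L + i)) \<le> C * (1 - \<rho> ^ 3) * \<rho> ^ i"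
    and "0 \<le> C" "0 \<le> \<rho>" "\<rho> \<le> 1"
    and "k < narayana (L + j)"
  shows "G k \<le> B + C * (1 - \<rho> ^ (j + 2))"
  using assms(7)
proof (induction j arbitrary: k rule: less_induct)
  case (less j)
  have mono: "B + C * (1 - \<rho> ^ m) \<le> B + C * (1 - \<rho> ^ n)" if "m \<le> n" for m n
    using that \<open>0 \<le> C\<close> \<open>0 \<le> \<rho>\<close> \<open>\<rho> \<le> 1\<close>
    by (intro add_left_mono mult_left_mono diff_left_mono power_decreasing)
  show ?case
  proof (cases j)
    case 0
    then show ?thesis using prefix[of k] mono[of 0 "j + 2"] less.prems by simp
  next
    case (Suc i)
    from less.prems have "k < narayana (Suc (L + i))" using Suc by simp
    then show ?thesis
    proof (cases rule: less_narayana_Suc_cases)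
      case below
      then have "G k \<le> B + C * (1 - \<rho> ^ (i + 2))" using less.IH[of i] Suc by simp
      then show ?thesis using mono[of "i + 2" "j + 2"] Suc by simp
    next
      case (add m)
      have "G m \<le> B + C * (1 - \<rho> ^ i)"
      proof (cases "2 \<le> i")
        case True
        then obtain l where "i = l + 2" by (metis le_add_diff_inverse2)
        then show ?thesis using less.IH[of l m] add(2) Suc by simp
      next
        case False
        then have "narayana (L + i - 2) \<le> narayana L" by (simp add: narayana_le_iff)
        then show ?thesis using prefix[of m] mono[of 0 i] add(2) by simp
      qed
      moreover have "G k = G (narayana (L + i)) + G m"
        using narayana_additiveD[OF additive] add by simp
      moreover have "C * (1 - \<rho> ^ 3) * \<rho> ^ i + C * (1 - \<rho> ^ i) = C * (1 - \<rho> ^ (j + 2))"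
        using Suc by (simp add: algebra_simps power_add power2_eq_square power3_eq_cube)
      ultimately show ?thesis using tail[of i] by simp
    qed
  qed
qed

lemma additive_le_geometric_tail:
  fixes G :: "nat \<Rightarrow> 'a::linordered_idom"
  assumes "narayana_additive G"
    and "\<And>k. k < narayana L \<Longrightarrow> G k \<le> B"
    and "\<And>i. G (narayana (L + i)) \<le> C * (1 - \<rho> ^ 3) * \<rho> ^ i"
    and "0 \<le> C" "0 \<le> \<rho>" "\<rho> \<le> 1"
  shows "G k \<le> B + C"
proof -
  have "k < narayana (L + k)" using less_narayana[of "L + k"] by simp
  with assms have "G k \<le> B + C * (1 - \<rho> ^ (k + 2))"
    by (rule additive_le_partial_geometric_tail)
  also have "\<dots> \<le> B + C" using \<open>0 \<le> C\<close> \<open>0 \<le> \<rho>\<close> by (simp add: algebra_simps)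
  finally show ?thesis .
qed

section \<open>Representations\<close>

definition word_value :: "nat list \<Rightarrow> nat" where
  "word_value w = (\<Sum>i = 1..length w. w ! (i - 1) * narayana (length w - i))"

definition admissible :: "nat list \<Rightarrow> bool" where
  "admissible w \<longleftrightarrow> set w \<subseteq> {0, 1} \<and> \<not> sublist [1, 1] w \<and> \<not> sublist [1, 0, 1] w"

lemma is_narayana_rep_iff:
  "is_narayana_rep w m \<longleftrightarrow> admissible w \<and> word_value w = m \<and> (w = [] \<or> hd w = 1)"
  by (auto simp: is_narayana_rep_def admissible_def word_value_def)

lemma word_value_Nil [simp]: "word_value [] = 0"
  by (simp add: word_value_def)

lemma word_value_Cons [simp]: "word_value (a # w) = a * narayana (length w) + word_value w"
proof -
  have "word_value (a # w) = a * narayana (length w) +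
      (\<Sum>i = Suc 1..Suc (length w). (a # w) ! (i - 1) * narayana (Suc (length w) - i))"
    unfolding word_value_def by (subst sum.atLeast_Suc_atMost) auto
  also have "(\<Sum>i = Suc 1..Suc (length w). (a # w) ! (i - 1) * narayana (Suc (length w) - i))
      = word_value w"
    unfolding word_value_def sum.shift_bounds_cl_Suc_ivl
    by (rule sum.cong) (auto simp: nth_Cons split: nat.splits)
  finally show ?thesis .
qed

lemma word_value_padded [simp]: "word_value (replicate n 0 @ w) = word_value w"
  by (induction n) auto

lemma admissible_Nil [simp]: "admissible []"
  by (simp add: admissible_def)

lemma admissible_digits: "admissible w \<Longrightarrow> a \<in> set w \<Longrightarrow> a = 0 \<or> a = 1"
  by (auto simp: admissible_def)

lemma admissible_drop: "admissible w \<Longrightarrow> admissible (drop n w)"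
  unfolding admissible_def by (meson order_trans set_drop_subset sublist_drop sublist_order.order_trans)

lemma admissible_Cons_prefix:
  "admissible (a # w) \<longleftrightarrow>
     admissible w \<and> (a = 0 \<or> a = 1 \<and> \<not> prefix [1] w \<and> \<not> prefix [0, 1] w)"
  by (auto simp: admissible_def sublist_Cons_right)

lemma no_leading_one_iff_word_value_less:
  assumes "admissible w" "word_value (drop 2 w) < narayana (length w - 2)"
  shows "\<not> prefix [1] w \<and> \<not> prefix [0, 1] w \<longleftrightarrow> word_value w < narayana (length w - 2)"
proof (cases w)
  case (Cons a u)
  then have "a = 0 \<or> a = 1" using admissible_digits[OF assms(1)] by simp
  then show ?thesis
  proof (cases u)
    case Nil
    then show ?thesis using \<open>a = 0 \<or> a = 1\<close> Cons by auto
  next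
    case (Cons b v)
    then have "b = 0 \<or> b = 1" using admissible_digits[OF assms(1)] \<open>w = a # u\<close> by simp
    then show ?thesis
      using \<open>a = 0 \<or> a = 1\<close> \<open>w = a # u\<close> Cons assms(2) by (elim disjE) (simp_all add: narayana_Suc)
  qed
qed simp

lemma word_value_less:
  assumes "admissible w"
  shows "word_value w < narayana (length w)"
  using assms
proof (induction "length w" arbitrary: w rule: less_induct)
  case less
  show ?case
  proof (cases w)
    case (Cons a u)
    have "word_value (drop 2 u) < narayana (length (drop 2 u))"
      using Cons less.prems admissible_drop[of w 3] by (intro less.hyps) simp_all
    moreover have "word_value u < narayana (length u)"
      using less.hyps less.prems Cons by (simp add: admissible_Cons_prefix)
    ultimately have "a * narayana (length u) + word_value u < narayana (Suc (length u))"
      using less.prems no_leading_one_iff_word_value_less[of u]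
      unfolding Cons admissible_Cons_prefix narayana_Suc by auto
    then show ?thesis using Cons by simp
  qed simp
qed

lemma admissible_Cons:
  "admissible (a # w) \<longleftrightarrow>
     admissible w \<and> (a = 0 \<or> a = 1 \<and> word_value w < narayana (length w - 2))"
  using no_leading_one_iff_word_value_less[of w] word_value_less[OF admissible_drop, of w 2]
  by (auto simp: admissible_Cons_prefix)

lemma admissible_padded [simp]: "admissible (replicate n 0 @ w) \<longleftrightarrow> admissible w"
  by (induction n) (simp_all add: admissible_Cons)

lemma word_value_inject:
  assumes "length v = length w" "admissible v" "admissible w" "word_value v = word_value w"
  shows "v = w"
  using assms
proof (induction v w rule: list_induct2)
  case (Cons a v b w)
  then have "admissible v" "admissible w" by (simp_all add: admissible_Cons)
  then have "word_value v < narayana (length v)" "word_value w < narayana (length w)"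
    by (simp_all only: word_value_less)
  then have "a = b" using Cons by (auto simp: admissible_Cons)
  then show ?case using Cons by (simp add: admissible_Cons)
qed simp

lemma is_narayana_rep_length_le_iff:
  assumes "is_narayana_rep w m"
  shows "length w \<le> n \<longleftrightarrow> m < narayana n"
proof
  assume "length w \<le> n"
  then have "narayana (length w) \<le> narayana n" by (simp add: narayana_le_iff)
  then show "m < narayana n" using assms word_value_less[of w] by (auto simp: is_narayana_rep_iff)
next
  assume m: "m < narayana n"
  show "length w \<le> n"
  proof (cases w)
    case (Cons a v)
    then have "narayana (length v) \<le> m" using assms by (auto simp: is_narayana_rep_iff)
    then have "\<not> narayana n \<le> narayana (length v)" using m by simp
    then show ?thesis using Cons by (simp add: narayana_le_iff)
  qed simp
qed

lemma is_narayana_rep_unique: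
  assumes "is_narayana_rep v m" "is_narayana_rep w m"
  shows "v = w"
proof (rule word_value_inject)
  show "length v = length w"
    using assms is_narayana_rep_length_le_iff by (metis order_antisym order_refl)
qed (use assms in \<open>simp_all add: is_narayana_rep_iff\<close>)

lemma is_narayana_rep_0: "is_narayana_rep [] 0"
  by (simp add: is_narayana_rep_iff)

lemma is_narayana_rep_add:
  assumes "is_narayana_rep w m" "m < narayana (n - 2)"
  shows "is_narayana_rep (1 # replicate (n - length w) 0 @ w) (narayana n + m)"
proof -
  have "length w \<le> n - 2" using assms by (simp add: is_narayana_rep_length_le_iff)
  then show ?thesis using assms by (simp add: is_narayana_rep_iff admissible_Cons)
qed

lemma is_narayana_rep_narayana_rep: "is_narayana_rep (narayana_rep m) m"
proof -
  have "\<exists>w. is_narayana_rep w m"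
    by (induction m rule: narayana_add_induct) (use is_narayana_rep_0 is_narayana_rep_add in blast)+
  then show ?thesis
    unfolding narayana_rep_def by (metis is_narayana_rep_unique theI')
qed

lemma narayana_rep_0: "narayana_rep 0 = []"
  using is_narayana_rep_narayana_rep is_narayana_rep_0 by (rule is_narayana_rep_unique)

lemma narayana_rep_add:
  assumes "m < narayana (n - 2)"
  shows "narayana_rep (narayana n + m) =
    1 # replicate (n - length (narayana_rep m)) 0 @ narayana_rep m"
  using is_narayana_rep_narayana_rep is_narayana_rep_add[OF is_narayana_rep_narayana_rep assms]
  by (rule is_narayana_rep_unique)

section \<open>The sets and their counting functions\<close>

lemma ends_one_zeros_Nil [simp]: "\<not> ends_one_zeros [] z"
  by (simp add: ends_one_zeros_def)

lemma ends_one_zeros_Cons: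
  "ends_one_zeros (a # w) z \<longleftrightarrow> ends_one_zeros w z \<or> a = 1 \<and> w = replicate z 0"
  by (auto simp: ends_one_zeros_def Cons_eq_append_conv)

lemma ends_one_zeros_padded [simp]:
  "ends_one_zeros (replicate n 0 @ w) z \<longleftrightarrow> ends_one_zeros w z"
  by (induction n) (auto simp: ends_one_zeros_Cons)

lemma ends_one_zeros_narayana_rep_add:
  assumes "m < narayana (n - 2)"
  shows "ends_one_zeros (narayana_rep (narayana n + m)) z \<longleftrightarrow>
    (if m = 0 then z = n else ends_one_zeros (narayana_rep m) z)"
proof (cases "m = 0")
  case True
  then show ?thesis
    using ends_one_zeros_padded[of n "[]" z] narayana_rep_add[OF assms]
    by (auto simp: narayana_rep_0 ends_one_zeros_Cons)
next
  case False
  then have "1 \<in> set (narayana_rep m)"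
    using is_narayana_rep_narayana_rep[of m]
    by (cases "narayana_rep m") (auto simp: is_narayana_rep_iff)
  then have "replicate i 0 @ narayana_rep m \<noteq> replicate z 0" for i
    by (metis Un_iff in_set_replicate set_append zero_neq_one)
  then show ?thesis using False by (simp add: narayana_rep_add[OF assms] ends_one_zeros_Cons)
qed

lemma ex1_ends_one_zeros: "0 < k \<Longrightarrow> \<exists>!z. ends_one_zeros (narayana_rep k) z"
proof (induction k rule: narayana_add_induct)
  case (add n m)
  then show ?case using ends_one_zeros_narayana_rep_add[OF add.hyps] by (cases "m = 0") auto
qed simp

lemma setA_iff: "k \<in> setA \<longleftrightarrow> 0 < k \<and> (\<exists>z. ends_one_zeros (narayana_rep k) z \<and> z mod 3 \<noteq> 1)"
proof -
  have "z mod 3 \<noteq> 1 \<longleftrightarrow> (\<exists>s. z = 3 * s \<or> z = 3 * s + 2)" for z :: nat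
    by presburger
  then show ?thesis by (auto simp: setA_def)
qed

lemma setB_iff: "k \<in> setB \<longleftrightarrow> 0 < k \<and> (\<exists>z. ends_one_zeros (narayana_rep k) z \<and> z mod 3 = 1)"
proof -
  have "z mod 3 = 1 \<longleftrightarrow> (\<exists>s. z = 3 * s + 1)" for z :: nat
    by presburger
  then show ?thesis by (auto simp: setB_def)
qed

lemma zero_notin_setA: "0 \<notin> setA"
  by (simp add: setA_def)

lemma setB_eq: "setB = {0<..} - setA"
proof (rule set_eqI)
  fix k
  show "k \<in> setB \<longleftrightarrow> k \<in> {0<..} - setA"
  proof (cases "0 < k")
    case True
    then obtain z where "\<And>z'. ends_one_zeros (narayana_rep k) z' \<longleftrightarrow> z' = z"
      using ex1_ends_one_zeros by metis
    then show ?thesis using True by (simp add: setA_iff setB_iff)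
  qed (simp add: setB_iff)
qed

lemma narayana_add_in_setA_iff:
  "m < narayana (n - 2) \<Longrightarrow>
     narayana n + m \<in> setA \<longleftrightarrow> (if m = 0 then n mod 3 \<noteq> 1 else m \<in> setA)"
  by (auto simp: setA_iff ends_one_zeros_narayana_rep_add)

lemma narayana_in_setA_iff: "narayana n \<in> setA \<longleftrightarrow> n mod 3 \<noteq> 1"
  using narayana_add_in_setA_iff[of 0 n] by simp

lemma infinite_setA: "infinite setA"
  unfolding infinite_nat_iff_unbounded
proof
  fix m
  have "m < narayana (3 * m)" using less_narayana[of "3 * m"] by simp
  then show "\<exists>n>m. n \<in> setA" using narayana_in_setA_iff[of "3 * m"] by auto
qed

lemma infinite_setB: "infinite setB"
  unfolding infinite_nat_iff_unbounded
proof
  fix m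
  have "m < narayana (3 * m + 1)" using less_narayana[of "3 * m + 1"] by simp
  moreover have "narayana (3 * m + 1) \<in> setB"
    unfolding setB_eq Diff_iff narayana_in_setA_iff by simp
  ultimately show "\<exists>n>m. n \<in> setB" by blast
qed

definition rank :: "nat set \<Rightarrow> nat \<Rightarrow> nat" where
  "rank S k = card (S \<inter> {..k})"

lemma rank_0: "0 \<notin> S \<Longrightarrow> rank S 0 = 0"
  by (simp add: rank_def)

lemma rank_Suc: "rank S (Suc k) = rank S k + of_bool (Suc k \<in> S)"
  by (simp add: rank_def atMost_Suc Int_insert_right)

lemma rank_add_rank_Diff:
  assumes "0 \<notin> S"
  shows "rank S k + rank ({0<..} - S) k = k"
  using assms by (induction k) (simp_all add: rank_0 rank_Suc)

lemma rank_enumerate: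
  assumes "infinite S"
  shows "rank S (enumerate S n) = Suc n"
proof -
  have "S \<inter> {..enumerate S n} = enumerate S ` {..n}"
    using assms enumerate_in_set[OF assms] enumerate_Ex[OF assms] by (force simp: image_iff)
  moreover have "inj_on (enumerate S) {..n}"
    using inj_enumerate[OF assms] by (rule inj_on_subset) simp
  ultimately show ?thesis by (simp add: rank_def card_image)
qed

lemma narayana_additive_rank_setA: "narayana_additive (rank setA)"
  unfolding narayana_additive_def
proof (intro allI impI)
  fix n m
  assume "m < narayana (n - 2)"
  then show "rank setA (narayana n + m) = rank setA (narayana n) + rank setA m"
  proof (induction m)
    case (Suc m)
    then show ?case using narayana_add_in_setA_iff[of "Suc m" n] by (simp add: rank_Suc)
  qed (simp add: rank_0 zero_notin_setA)
qed

lemma rank_setA_1_2_3: "rank setA 1 = 1" "rank setA 2 = 1" "rank setA 3 = 2"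
proof -
  have "1 \<in> setA" "2 \<notin> setA" "3 \<in> setA"
    using narayana_in_setA_iff[of 0] narayana_in_setA_iff[of "Suc 0"]
      narayana_in_setA_iff[of "Suc (Suc 0)"] by simp_all
  then show "rank setA 1 = 1" "rank setA 2 = 1" "rank setA 3 = 2"
    by (simp_all add: rank_Suc rank_0 zero_notin_setA numeral_2_eq_2 numeral_3_eq_3)
qed

lemma rank_setA_narayana_add_3:
  "rank setA (narayana (n + 3)) = rank setA (narayana (n + 2)) + rank setA (narayana n)"
proof -
  obtain m where m: "narayana n = Suc m" using narayana_pos gr0_implies_Suc by blast
  have "rank setA (narayana (n + 3)) =
      rank setA (narayana (n + 2) + m) + of_bool (narayana (n + 3) \<in> setA)"
    using rank_Suc[of setA "narayana (n + 2) + m"] by (simp add: narayana_add_3 m)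
  moreover have "narayana (n + 3) \<in> setA \<longleftrightarrow> narayana n \<in> setA"
    by (simp only: narayana_in_setA_iff mod_add_self2)
  moreover have "rank setA (narayana (n + 2) + m) = rank setA (narayana (n + 2)) + rank setA m"
    using m by (intro narayana_additiveD narayana_additive_rank_setA) simp
  moreover have "rank setA (narayana n) = rank setA m + of_bool (narayana n \<in> setA)"
    unfolding m by (rule rank_Suc)
  ultimately show ?thesis by simp
qed

lemma rank_setA_narayana: "rank setA (narayana n) = narayana (n - 1)"
proof (induction n rule: narayana.induct)
  case (4 n)
  have "rank setA (narayana (n + 3)) = narayana (n + 1) + narayana (n - 1)"
    using 4 by (simp add: rank_setA_narayana_add_3)
  also have "\<dots> = narayana (n + 2)" using narayana_Suc[of "n + 1"] by simp
  finally show ?case by (simp add: numeral_3_eq_3)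
qed (use rank_setA_1_2_3 in simp_all)

section \<open>The discrepancy\<close>

lemma cubic_strict_mono:
  fixes x y :: "'a::linordered_idom"
  assumes "1 \<le> x" "x < y"
  shows "x ^ 3 - x ^ 2 < y ^ 3 - y ^ 2"
proof -
  have "x ^ 2 * (x - 1) < y ^ 2 * (y - 1)"
    using assms by (intro mult_strict_mono' power_strict_mono) auto
  then show ?thesis by (simp add: algebra_simps power2_eq_square power3_eq_cube)
qed

lemma cubic_root_ge_1:
  fixes x :: "'a::linordered_idom"
  assumes "x ^ 3 - x ^ 2 - 1 = 0"
  shows "1 \<le> x"
proof (rule ccontr)
  assume "\<not> 1 \<le> x"
  then have "x ^ 2 * (x - 1) \<le> 0" by (intro mult_nonneg_nonpos) auto
  then show False using assms by (simp add: algebra_simps power2_eq_square power3_eq_cube)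
qed

lemma alpha_root: "alpha ^ 3 - alpha ^ 2 - 1 = 0"
proof -
  have "\<exists>x\<ge>1. x \<le> 2 \<and> x ^ 3 - x ^ 2 - 1 = (0::real)"
    by (rule IVT') (auto intro!: continuous_intros)
  then obtain x :: real where x: "x ^ 3 - x ^ 2 - 1 = 0" by blast
  have "y = x" if "y ^ 3 - y ^ 2 - 1 = 0" for y :: real
    using cubic_strict_mono[of x y] cubic_strict_mono[of y x] x that
      cubic_root_ge_1[of x] cubic_root_ge_1[of y] by (cases x y rule: linorder_cases) auto
  with x show ?thesis unfolding alpha_def by (rule theI)
qed

lemma alpha_cubed: "alpha ^ 3 = alpha ^ 2 + 1"
  using alpha_root by simp

lemma
  assumes "1 \<le> x"
  shows less_alpha_iff: "x < alpha \<longleftrightarrow> x ^ 3 - x ^ 2 < 1"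
    and alpha_less_iff: "alpha < x \<longleftrightarrow> 1 < x ^ 3 - x ^ 2"
  using assms cubic_strict_mono[of x alpha] cubic_strict_mono[of alpha x]
    cubic_root_ge_1[OF alpha_root] alpha_cubed
  by (cases x alpha rule: linorder_cases; simp)+

lemma alpha_bounds: "1.46557123 < alpha" "alpha < 1.46557124"
  by (subst less_alpha_iff alpha_less_iff; simp add: power_divide)+

lemma alpha_square_bounds: "2.147898 < alpha ^ 2" "alpha ^ 2 < 2.1479"
proof -
  have "1.46557123 ^ 2 < alpha ^ 2" "alpha ^ 2 < 1.46557124 ^ 2"
    using alpha_bounds by (intro power_strict_mono; simp)+
  then show "2.147898 < alpha ^ 2" "alpha ^ 2 < 2.1479"
    by (simp_all add: power_divide)
qed

text \<open>The left-hand side comes from $X^3 - X^2 - 1 = (X - c)(X^2 + (c-1)X + c(c-1))$.\<close>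

lemma narayana_recurrence_component:
  fixes x :: "nat \<Rightarrow> 'a::comm_ring_1"
  assumes c: "c ^ 3 = c ^ 2 + 1" and rec: "\<And>n. x (n + 3) = x (n + 2) + x n"
  shows "x (n + 2) + (c - 1) * x (n + 1) + c * (c - 1) * x n =
    c ^ n * (x 2 + (c - 1) * x 1 + c * (c - 1) * x 0)"
proof (induction n)
  case (Suc n)
  have "x (n + 3) + (c - 1) * x (n + 2) + c * (c - 1) * x (n + 1) =
      c * (x (n + 2) + (c - 1) * x (n + 1) + c * (c - 1) * x n) + (1 - (c ^ 3 - c ^ 2)) * x n"
    unfolding rec by (simp add: algebra_simps power2_eq_square power3_eq_cube)
  also have "\<dots> = c ^ Suc n * (x 2 + (c - 1) * x 1 + c * (c - 1) * x 0)"
    using c unfolding Suc by (simp add: mult.assoc)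
  finally show ?case by (simp add: numeral_3_eq_3)
qed (simp add: numeral_2_eq_2)

lemma second_order_recurrence_form:
  fixes x :: "nat \<Rightarrow> 'a::comm_ring_1"
  assumes rec: "\<And>n. x (n + 2) = - p * x (n + 1) - q * x n"
  shows "x (n + 1) ^ 2 + p * x n * x (n + 1) + q * x n ^ 2 =
    q ^ n * (x 1 ^ 2 + p * x 0 * x 1 + q * x 0 ^ 2)"
proof (induction n)
  case (Suc n)
  have "x (n + 2) ^ 2 + p * x (n + 1) * x (n + 2) + q * x (n + 1) ^ 2 =
      q * (x (n + 1) ^ 2 + p * x n * x (n + 1) + q * x n ^ 2)"
    unfolding rec by (simp add: algebra_simps power2_eq_square)
  then show ?case unfolding Suc by (simp add: mult.assoc)
qed simp

lemma second_order_recurrence_square_le: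
  fixes x :: "nat \<Rightarrow> 'a::linordered_field"
  assumes "\<And>n. x (n + 2) = - p * x (n + 1) - q * x n"
  shows "(q - p ^ 2 / 4) * x n ^ 2 \<le> q ^ n * (x 1 ^ 2 + p * x 0 * x 1 + q * x 0 ^ 2)"
proof -
  have "(q - p ^ 2 / 4) * x n ^ 2 \<le> (x (n + 1) + p / 2 * x n) ^ 2 + (q - p ^ 2 / 4) * x n ^ 2"
    by simp
  also have "\<dots> = x (n + 1) ^ 2 + p * x n * x (n + 1) + q * x n ^ 2"
    by (simp add: field_simps power2_eq_square)
  also have "\<dots> = q ^ n * (x 1 ^ 2 + p * x 0 * x 1 + q * x 0 ^ 2)"
    using assms by (rule second_order_recurrence_form)
  finally show ?thesis .
qed

definition narayana_error :: "real \<Rightarrow> nat \<Rightarrow> real" where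
  "narayana_error c n = real (narayana n) - c * real (narayana (n - 1))"

lemma narayana_error_0_1_2:
  "narayana_error c 0 = 1 - c"
  "narayana_error c 1 = 2 - c"
  "narayana_error c 2 = 3 - 2 * c"
  by (simp_all add: narayana_error_def numeral_2_eq_2)

lemma narayana_error_add_3:
  "narayana_error c (n + 3) = narayana_error c (n + 2) + narayana_error c n"
proof -
  have "narayana (n + 3 - 1) = narayana (n + 2 - 1) + narayana (n - 1)"
    using narayana_Suc[of "n + 1"] by simp
  then show ?thesis by (simp only: narayana_error_def narayana_add_3 of_nat_add ring_distribs)
qed

lemma narayana_error_antimono: "c \<le> d \<Longrightarrow> narayana_error d n \<le> narayana_error c n"
  by (simp add: narayana_error_def mult_right_mono)

lemma narayana_error_alpha_order_two:
  "narayana_error alpha (n + 2) =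
     - (alpha - 1) * narayana_error alpha (n + 1) - alpha * (alpha - 1) * narayana_error alpha n"
proof -
  have "narayana_error alpha 2 + (alpha - 1) * narayana_error alpha 1
      + alpha * (alpha - 1) * narayana_error alpha 0 = alpha ^ 2 + 1 - alpha ^ 3"
    unfolding narayana_error_0_1_2 by (simp add: algebra_simps power2_eq_square power3_eq_cube)
  then show ?thesis
    using alpha_cubed
      narayana_recurrence_component[of alpha "narayana_error alpha" n, OF alpha_cubed narayana_error_add_3]
    by (simp add: algebra_simps)
qed

text \<open>The rate $0.8261$ is slightly larger than $\alpha^{-1/2}$.\<close>

lemma abs_narayana_error_alpha_le: "\<bar>narayana_error alpha n\<bar> \<le> 0.72 * 0.8261 ^ n"
proof -
  let ?d = "narayana_error alpha" and ?p = "alpha - 1" and ?q = "alpha * (alpha - 1)"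
  have q: "?q = alpha ^ 2 - alpha" "?p ^ 2 = alpha ^ 2 - 2 * alpha + 1"
    by (simp_all add: algebra_simps power2_eq_square)
  have "?d 1 ^ 2 + ?p * ?d 0 * ?d 1 + ?q * ?d 0 ^ 2 =
      1 + alpha - alpha ^ 2 + (alpha - 1) * (alpha ^ 3 - alpha ^ 2 - 1)"
    unfolding narayana_error_0_1_2 by (simp add: algebra_simps power2_eq_square power3_eq_cube)
  then have initial: "?d 1 ^ 2 + ?p * ?d 0 * ?d 1 + ?q * ?d 0 ^ 2 \<le> 0.3178"
    using alpha_root alpha_bounds alpha_square_bounds by simp
  have "0.62 \<le> ?q - ?p ^ 2 / 4"
    using alpha_bounds alpha_square_bounds unfolding q by (simp add: field_simps)
  then have "0.62 * ?d n ^ 2 \<le> (?q - ?p ^ 2 / 4) * ?d n ^ 2"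
    by (intro mult_right_mono) simp_all
  also have "\<dots> \<le> ?q ^ n * (?d 1 ^ 2 + ?p * ?d 0 * ?d 1 + ?q * ?d 0 ^ 2)"
    using narayana_error_alpha_order_two by (rule second_order_recurrence_square_le)
  also have "\<dots> \<le> ?q ^ n * 0.3178"
    using alpha_bounds by (intro mult_left_mono initial) simp
  also have "\<dots> \<le> (0.8261 ^ 2) ^ n * 0.3178"
    using alpha_bounds alpha_square_bounds unfolding q
    by (intro mult_right_mono power_mono) (simp_all add: power_divide)
  also have "\<dots> \<le> (0.8261 ^ 2) ^ n * (0.62 * 0.72 ^ 2)"
    by (intro mult_left_mono) (simp_all add: power_divide)
  also have "\<dots> = 0.62 * (0.72 * 0.8261 ^ n) ^ 2"
    by (simp only: power_mult_distrib power_mult[symmetric] mult.commute[of 2 n] ac_simps)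
  finally have "?d n ^ 2 \<le> (0.72 * 0.8261 ^ n) ^ 2" by simp
  then show ?thesis by (simp add: abs_le_square_iff[symmetric])
qed

definition discrepancy :: "nat \<Rightarrow> real" where
  "discrepancy k = real k - alpha * real (rank setA k)"

lemma narayana_additive_discrepancy: "narayana_additive discrepancy"
  using narayana_additive_rank_setA
  by (simp add: narayana_additive_def discrepancy_def algebra_simps)

lemma discrepancy_narayana: "discrepancy (narayana n) = narayana_error alpha n"
  by (simp add: discrepancy_def narayana_error_def rank_setA_narayana)

text \<open>The constant exceeds the tail $0.72 \cdot 0.8261^{25} / (1 - 0.8261^3)$.\<close>

lemma additive_le_max_digit_sum_25:
  fixes G :: "nat \<Rightarrow> real"
  assumes "narayana_additive G"
    and "\<And>n. G (narayana n) \<le> v n"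
    and tail: "\<And>n. G (narayana n) \<le> 0.72 * 0.8261 ^ n"
  shows "G k \<le> max_digit_sum v 25 + 0.0141"
proof (rule additive_le_geometric_tail[OF assms(1)])
  show "G m \<le> max_digit_sum v 25" if "m < narayana 25" for m
    using assms(1,2) that by (rule additive_le_max_digit_sum)
  show "G (narayana (25 + i)) \<le> 0.0141 * (1 - 0.8261 ^ 3) * 0.8261 ^ i" for i
  proof -
    have "0.72 * 0.8261 ^ (25 + i) \<le> 0.0141 * (1 - 0.8261 ^ 3) * (0.8261::real) ^ i"
      unfolding power_add mult.assoc[symmetric]
      by (intro mult_right_mono) (simp_all add: power_divide)
    then show ?thesis by (rule order_trans[OF tail])
  qed
qed simp_all

lemma discrepancy_less: "discrepancy k < 1.0466"
proof -
  let ?v = "narayana_error 1.46557123"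
  have "discrepancy k \<le> max_digit_sum ?v 25 + 0.0141"
  proof (rule additive_le_max_digit_sum_25[OF narayana_additive_discrepancy])
    fix n
    show "discrepancy (narayana n) \<le> ?v n"
      using alpha_bounds by (simp add: discrepancy_narayana narayana_error_antimono)
    show "discrepancy (narayana n) \<le> 0.72 * 0.8261 ^ n"
      using abs_narayana_error_alpha_le[of n] by (simp add: discrepancy_narayana)
  qed
  also have "max_digit_sum ?v 25 < 1.0325"
    unfolding max_digit_sum_eq_iter_0[OF narayana_error_add_3] narayana_error_0_1_2
    by (simp add: numeral_eq_Suc max_def)
  finally show ?thesis by simp
qed

lemma discrepancy_greater: "- 1.2598 < discrepancy k"
proof -
  let ?v = "\<lambda>n. - narayana_error 1.46557124 n"
  have "- discrepancy k \<le> max_digit_sum ?v 25 + 0.0141"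
  proof (rule additive_le_max_digit_sum_25)
    show "narayana_additive (\<lambda>k. - discrepancy k)"
      using narayana_additive_discrepancy by (rule narayana_additive_uminus)
    fix n
    show "- discrepancy (narayana n) \<le> ?v n"
      using alpha_bounds by (simp add: discrepancy_narayana narayana_error_antimono)
    show "- discrepancy (narayana n) \<le> 0.72 * 0.8261 ^ n"
      using abs_narayana_error_alpha_le[of n] by (simp add: discrepancy_narayana)
  qed
  also have "max_digit_sum ?v 25 < 1.2457"
  proof -
    have rec: "?v (n + 3) = ?v (n + 2) + ?v n" for n
      by (simp add: narayana_error_add_3)
    show ?thesis
      unfolding max_digit_sum_eq_iter_0[of ?v, OF rec] narayana_error_0_1_2
      by (simp add: numeral_eq_Suc max_def)
  qed
  finally show ?thesis by simp
qed

lemma discrepancy_setA_less: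
  assumes "k \<in> setA"
  shows "discrepancy k < 2.0466 - alpha"
proof -
  obtain l where "k = Suc l" using assms by (cases k) (auto simp: zero_notin_setA)
  then have "discrepancy k = discrepancy l + 1 - alpha"
    using assms by (simp add: discrepancy_def rank_Suc algebra_simps)
  then show ?thesis using discrepancy_less[of l] by simp
qed

lemma discrepancy_setB_greater:
  assumes "k \<in> setB"
  shows "- 0.2598 < discrepancy k"
proof -
  obtain l where "k = Suc l" using assms by (cases k) (auto simp: setB_eq)
  then have "discrepancy k = discrepancy l + 1"
    using assms by (simp add: discrepancy_def rank_Suc setB_eq)
  then show ?thesis using discrepancy_greater[of l] by simp
qed

section \<open>The two sequences\<close>

lemma seqA_in_setA: "seqA i \<in> setA"
  unfolding seqA_def by (rule enumerate_in_set[OF infinite_setA])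

lemma seqB_in_setB: "seqB i \<in> setB"
  unfolding seqB_def by (rule enumerate_in_set[OF infinite_setB])

lemma seqA_error_eq_discrepancy:
  "1 \<le> i \<Longrightarrow> real (seqA i) - alpha * real i = discrepancy (seqA i)"
  using rank_enumerate[OF infinite_setA, of "i - 1"] by (simp add: discrepancy_def seqA_def)

lemma seqB_error_eq_discrepancy:
  assumes "1 \<le> i"
  shows "real (seqB i) - alpha ^ 3 * real i = - (alpha ^ 2) * discrepancy (seqB i)"
proof -
  have "rank setA (seqB i) + i = seqB i"
    using assms rank_enumerate[OF infinite_setB, of "i - 1"]
      rank_add_rank_Diff[OF zero_notin_setA, of "seqB i"]
    by (simp add: seqB_def setB_eq)
  then have "real (rank setA (seqB i)) = real (seqB i) - real i" by linarith
  then show ?thesis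
    unfolding discrepancy_def using alpha_cubed by algebra
qed

theorem theorem26:
  shows "(\<forall>i::nat. i \<ge> 1 \<longrightarrow>
            -1.2630921 < real (seqA i) - alpha * real i \<and>
            real (seqA i) - alpha * real i < 0.58304372) \<and>
         (\<forall>i::nat. i \<ge> 1 \<longrightarrow>
            -2.2480941 < real (seqB i) - alpha ^ 3 * real i \<and>
            real (seqB i) - alpha ^ 3 * real i < 0.558039)"
proof (intro conjI allI impI)
  fix i :: nat
  assume "1 \<le> i"
  note errors = seqA_error_eq_discrepancy[OF this] seqB_error_eq_discrepancy[OF this]
  show "-1.2630921 < real (seqA i) - alpha * real i"
    using discrepancy_greater[of "seqA i"] by (simp add: errors)
  show "real (seqA i) - alpha * real i < 0.58304372"
    using discrepancy_setA_less[OF seqA_in_setA, of i] alpha_bounds by (simp add: errors)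
  have "alpha ^ 2 * discrepancy (seqB i) < alpha ^ 2 * 1.0466"
    using discrepancy_less alpha_square_bounds by (intro mult_strict_left_mono) auto
  then show "-2.2480941 < real (seqB i) - alpha ^ 3 * real i"
    using alpha_square_bounds by (simp add: errors)
  have "alpha ^ 2 * (- 0.2598) < alpha ^ 2 * discrepancy (seqB i)"
    using discrepancy_setB_greater[OF seqB_in_setB] alpha_square_bounds
    by (intro mult_strict_left_mono) auto
  then show "real (seqB i) - alpha ^ 3 * real i < 0.558039"
    using alpha_square_bounds by (simp add: errors)
qed

end
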